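(* Let $P_m$ be the path graph on $m \geq 4$ vertices, with adjacency matrix $A$, and let $u,v$ be its two endpoints. For every real diagonal matrix $Q$ (a potential on the vertices), there is no time $T\in\mathbb{R}$ at which perfect state transfer from $u$ to $v$ occurs for the Hamiltonian $H = A - Q$.
   Context: For a graph $G$ with adjacency matrix $A$ and a real diagonal matrix $Q$ (the potential, whose diagonal entries are real values assigned to the vertices), the Hamiltonian is $H = A - Q$ and $U(t) = e^{itH}$. Perfect state transfer from vertex $u$ to vertex $v$ occurs at time $T$ if $|U(T)_{u,v}| = 1$, equivalently $U(T)\mathbf{1}_u = \gamma \mathbf{1}_v$ for some $\gamma\in\mathbb{C}$ with $|\gamma|=1$, where $\mathbf{1}_w$ is the indicator vector of vertex $w$. Here "path of length $m$" means the path on $m$ vertices. *)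

theory Defs
  imports Complex_Main "Jordan_Normal_Form.Matrix"
begin

definition path_adj :: "nat \<Rightarrow> complex mat" where
  "path_adj m = mat m m (\<lambda>(i, j). if i + 1 = j \<or> j + 1 = i then 1 else 0)"

definition potential_mat :: "nat \<Rightarrow> (nat \<Rightarrow> real) \<Rightarrow> complex mat" where
  "potential_mat m q = mat m m (\<lambda>(i, j). if i = j then complex_of_real (q i) else 0)"

definition hamiltonian :: "nat \<Rightarrow> (nat \<Rightarrow> real) \<Rightarrow> complex mat" where
  "hamiltonian m q = path_adj m - potential_mat m q"

text \<open>U(t) = exp(i t H), defined entrywise by the exponential power series.\<close>
definition evolution :: "complex mat \<Rightarrow> real \<Rightarrow> complex mat" where
  "evolution H t = mat (dim_row H) (dim_col H)
     (\<lambda>(i, j). \<Sum>k. ((\<i> * complex_of_real t) ^ k / of_nat (fact k)) * (H ^\<^sub>m k) $$ (i, j))"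

definition pst :: "complex mat \<Rightarrow> nat \<Rightarrow> nat \<Rightarrow> real \<Rightarrow> bool" where
  "pst H u v T \<longleftrightarrow> cmod (evolution H T $$ (u, v)) = 1"

end

(*
  Let P_j be the monic polynomials of the Jacobi matrix H, so that (P_0(x), ..., P_(m-1)(x)) is an
  eigenvector for each of the m simple real roots x of P_m.  If transfer occurs at time T, then row 0
  of U(T) is supported in the last column, so exp(iTx) = gamma P_(m-1)(x) at every root x.
  Hence P_(m-1)(x) is a sign, the potential is mirror symmetric, and P_m factors as R S with R
  vanishing at the roots of sign 1 and S at those of sign -1; moreover roots of opposite sign differ
  by odd multiples of g = pi/T.  For m = 2k one has R = P_k - P_(k-1), S = P_k + P_(k-1), and for
  m = 2k+1 one has R = P_(k+1) - P_(k-1), S = P_k.  In both cases |Res(R, S)| = 2^k, because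
  |Res(P_n, P_(n+1))| = 1 when all off-diagonal entries are 1.  On the other hand the resultant is a
  power of g times an odd integer, and comparing power sums of the roots of R and S gives
  g N = 2 (even m) or g^2 N = 4 (odd m) for an integer N.  The resulting 2-adic valuations are
  incompatible as soon as k >= 2.
*)
theory Submission
  imports Defs "Jordan_Normal_Form.Determinant"
    "HOL-Computational_Algebra.Fundamental_Theorem_Algebra"
begin

section \<open>Characteristic polynomials of the Jacobi matrix\<close>

text \<open>The diagonal of the Hamiltonian is \<open>-q\<close>, so \<open>jac q n\<close> is the characteristic polynomial of its leading
  \<open>n\<close> by \<open>n\<close> block.\<close>

fun jac :: "(nat \<Rightarrow> real) \<Rightarrow> nat \<Rightarrow> complex poly" where
  "jac q 0 = 1"
| "jac q (Suc 0) = [:complex_of_real (q 0), 1:]"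
| "jac q (Suc (Suc n)) = [:complex_of_real (q (Suc n)), 1:] * jac q (Suc n) - jac q n"

lemma jac_monic: "degree (jac q n) = n \<and> coeff (jac q n) n = 1"
proof (induction q n rule: jac.induct)
  case (3 q n)
  let ?l = "[:complex_of_real (q (Suc n)), 1:]"
  have "jac q (Suc n) \<noteq> 0"
    using "3.IH"(1) by auto
  then have 1: "degree (?l * jac q (Suc n)) = Suc (Suc n)"
    using "3.IH"(1) by (subst degree_mult_eq) auto
  then have 2: "degree (jac q (Suc (Suc n))) = Suc (Suc n)"
    using "3.IH"(2) degree_add_eq_left[of "- jac q n" "?l * jac q (Suc n)"] by simp
  have "coeff (jac q n) (Suc (Suc n)) = 0" "coeff (jac q (Suc n)) (Suc (Suc n)) = 0"
    using "3.IH" by (auto intro!: coeff_eq_0)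
  then show ?case using 2 "3.IH"(1) by simp
qed auto

lemmas degree_jac [simp] = jac_monic[THEN conjunct1]
lemmas lead_coeff_jac [simp] = jac_monic[THEN conjunct2]

lemma jac_nonzero [simp]: "jac q n \<noteq> 0"
  using lead_coeff_jac[of q n] by force

lemma poly_jac_cnj: "poly (jac q n) (cnj x) = cnj (poly (jac q n) x)"
  by (induction q n rule: jac.induct) (auto simp: algebra_simps)

text \<open>Induction on \<open>n\<close> with the three-term recurrence: the potential cancels and
  the rest telescopes. No weights appear because the off-diagonal entries are all 1.\<close>

lemma christoffel_darboux:
  "(x - y) * (\<Sum>j\<le>n. poly (jac q j) x * poly (jac q j) y) =
     poly (jac q (Suc n)) x * poly (jac q n) y - poly (jac q n) x * poly (jac q (Suc n)) y"
  by (induction n) (auto simp: algebra_simps)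

text \<open>The confluent case \<open>y = x\<close>, obtained from the differentiated recurrence
  instead of a limit.\<close>

lemma christoffel_darboux_diag:
  "(\<Sum>j\<le>n. poly (jac q j) x ^ 2) =
     poly (pderiv (jac q (Suc n))) x * poly (jac q n) x - poly (pderiv (jac q n)) x * poly (jac q (Suc n)) x"
  by (induction n) (auto simp: algebra_simps power2_eq_square pderiv_diff pderiv_add pderiv_smult pderiv_mult pderiv_pCons)

lemma sum_norm_jac_pos: "0 < (\<Sum>j\<le>n. (cmod (poly (jac q j) x))\<^sup>2)"
  by (rule sum_pos2[of _ 0]) auto

text \<open>For \<open>y = cnj x\<close>, also a root, the right side of Christoffel-Darboux
  vanishes, while the sum on the left consists of squared moduli, the one for \<open>j = 0\<close>
  being 1.\<close>

lemma jac_root_real: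
  assumes "poly (jac q n) x = 0"
  shows "cnj x = x"
proof (cases n)
  case (Suc k)
  have "(x - cnj x) * (\<Sum>j\<le>k. poly (jac q j) x * poly (jac q j) (cnj x)) = 0"
    using assms unfolding christoffel_darboux Suc by (simp add: poly_jac_cnj)
  moreover have "(\<Sum>j\<le>k. poly (jac q j) x * poly (jac q j) (cnj x))
      = of_real (\<Sum>j\<le>k. (cmod (poly (jac q j) x))\<^sup>2)"
    by (simp add: poly_jac_cnj flip: complex_norm_square)
  ultimately show ?thesis
    using sum_norm_jac_pos[of q x k] by (simp del: of_real_sum)
qed (use assms in auto)

lemma jac_at_real:
  assumes "cnj x = x"
  shows "cnj (poly (jac q n) x) = poly (jac q n) x"
  using poly_jac_cnj[of q n x] assms by simp

text \<open>A double root annihilates the right side of the confluent identity; as the root is real,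
  the left side is a positive sum of squares.\<close>

lemma jac_rsquarefree: "rsquarefree (jac q n)"
proof (cases n)
  case (Suc k)
  show ?thesis
    unfolding rsquarefree_roots
  proof (intro allI notI)
    fix x assume x: "poly (jac q n) x = 0 \<and> poly (pderiv (jac q n)) x = 0"
    then have c: "cnj x = x" using jac_root_real by blast
    have "(\<Sum>j\<le>k. poly (jac q j) x ^ 2) = 0"
      using x unfolding christoffel_darboux_diag Suc by simp
    moreover have "(\<Sum>j\<le>k. poly (jac q j) x ^ 2)
      = of_real (\<Sum>j\<le>k. (cmod (poly (jac q j) x))\<^sup>2)"
      by (simp add: complex_norm_square jac_at_real[OF c] power2_eq_square[of "poly _ _"] del: of_real_power)
    ultimately show False
      using sum_norm_jac_pos[of q x k] by (simp del: of_real_sum)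
  qed
qed (auto simp: rsquarefree_roots)

section \<open>Root sets and their power sums\<close>

abbreviation jac_roots :: "(nat \<Rightarrow> real) \<Rightarrow> nat \<Rightarrow> complex set" where
  "jac_roots q n \<equiv> {z. poly (jac q n) z = 0}"

lemma finite_jac_roots [simp]: "finite (jac_roots q n)"
  by (simp add: poly_roots_finite)

lemma degree_prod_linear: "degree (\<Prod>z\<in>A. [:- z, 1:]) = card A" for A :: "complex set"
  by (simp add: degree_prod_sum_eq)

lemma jac_eq_prod: "jac q n = (\<Prod>z\<in>jac_roots q n. [:- z, 1:])"
  using complex_poly_decompose_rsquarefree[OF jac_rsquarefree, of q n] by simp

lemma card_jac_roots [simp]: "card (jac_roots q n) = n"
  using degree_prod_linear degree_jac jac_eq_prod by metis

text \<open>Equal degree, equal leading coefficient and agreement on \<open>card A\<close> points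
  force equality. For infinite \<open>A\<close> both sides are 1, since
  \<open>card A = 0\<close>.\<close>

lemma monic_eq_prod:
  fixes f :: "complex poly"
  assumes "degree f = card A" "lead_coeff f = 1" "\<And>a. a \<in> A \<Longrightarrow> poly f a = 0"
  shows "f = (\<Prod>z\<in>A. [:- z, 1:])"
proof (cases "finite A")
  case True
  show ?thesis
  proof (rule poly_eqI_degree_lead_coeff[of _ "card A" _ A])
    show "coeff f (card A) = coeff (\<Prod>z\<in>A. [:- z, 1:]) (card A)"
      using assms lead_coeff_prod[of "\<lambda>z. [:- z, 1:]" A] by (simp add: degree_prod_linear)
  qed (use assms True in \<open>auto simp: degree_prod_linear poly_prod\<close>)
next
  case False
  then show ?thesis using assms by (auto elim!: degree_eq_zeroE)
qed

lemma coeff_prod_linear_e1: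
  fixes A :: "complex set"
  assumes "finite A" "card A = Suc n"
  shows "coeff (\<Prod>z\<in>A. [:- z, 1:]) n = - \<Sum>A"
  using assms
proof (induction A arbitrary: n rule: finite_induct)
  case (insert a A)
  have l: "coeff (\<Prod>z\<in>A. [:- z, 1:]) (card A) = 1"
    using lead_coeff_prod[of "\<lambda>z. [:- z, 1:]" A] by (simp add: degree_prod_linear)
  have n: "n = card A" using insert by auto
  show ?case
  proof (cases n)
    case 0
    then show ?thesis using insert n by auto
  next
    case (Suc k)
    then show ?thesis using insert n l by (auto simp: coeff_pCons)
  qed
qed auto

text \<open>Newton's identity 2 e_2 = p_1^2 - p_2 between elementary symmetric functions and power
  sums.\<close>

lemma coeff_prod_linear_e2:
  fixes A :: "complex set"
  assumes "finite A" "card A = Suc (Suc n)"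
  shows "2 * coeff (\<Prod>z\<in>A. [:- z, 1:]) n = (\<Sum>A)\<^sup>2 - (\<Sum>a\<in>A. a\<^sup>2)"
  using assms
proof (induction A arbitrary: n rule: finite_induct)
  case (insert a A)
  have n: "card A = Suc n" using insert by auto
  note l = coeff_prod_linear_e1[OF insert.hyps(1) n]
  show ?case
  proof (cases n)
    case 0
    then obtain b where "A = {b}" using n by (auto simp: card_1_singleton_iff)
    then show ?thesis using insert 0 by (auto simp: algebra_simps power2_eq_square)
  next
    case (Suc k)
    then show ?thesis using insert n l by (auto simp: coeff_pCons algebra_simps power2_eq_square)
  qed
qed auto

section \<open>Resultants of consecutive polynomials\<close>

lemma cmod_prod_poly_swap:
  fixes A B :: "complex set"
  shows "cmod (\<Prod>a\<in>A. poly (\<Prod>z\<in>B. [:- z, 1:]) a) = cmod (\<Prod>b\<in>B. poly (\<Prod>z\<in>A. [:- z, 1:]) b)"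
proof -
  have "cmod (\<Prod>a\<in>A. poly (\<Prod>z\<in>B. [:- z, 1:]) a) = (\<Prod>a\<in>A. \<Prod>b\<in>B. cmod (a - b))"
    by (simp add: poly_prod flip: prod_norm)
  also have "\<dots> = (\<Prod>b\<in>B. \<Prod>a\<in>A. cmod (b - a))"
    by (subst prod.swap) (simp add: norm_minus_commute)
  also have "\<dots> = cmod (\<Prod>b\<in>B. poly (\<Prod>z\<in>A. [:- z, 1:]) b)"
    by (simp add: poly_prod flip: prod_norm)
  finally show ?thesis .
qed

text \<open>A Euclidean step: at a root of \<open>jac q (Suc n)\<close> the values of
  \<open>jac q (Suc (Suc n))\<close> and \<open>- jac q n\<close> coincide, so the modulus of the
  resultant passes down unchanged to \<open>jac q 0 = 1\<close>.\<close>

lemma jac_resultant: "cmod (\<Prod>a\<in>jac_roots q (Suc n). poly (jac q n) a) = 1"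
proof (induction n)
  case (Suc n)
  have "cmod (\<Prod>a\<in>jac_roots q (Suc (Suc n)). poly (jac q (Suc n)) a)
      = cmod (\<Prod>a\<in>jac_roots q (Suc n). poly (jac q (Suc (Suc n))) a)"
    using cmod_prod_poly_swap jac_eq_prod by metis
  also have "\<dots> = cmod (\<Prod>a\<in>jac_roots q (Suc n). poly (jac q n) a)"
    by (simp flip: prod_norm)
  finally show ?case using Suc by simp
qed auto

text \<open>Inverse uniqueness: subtracting the two recurrences equates a multiple of the middle
  polynomial with a difference of lower degree, so the multiplier, a difference of potential values,
  is zero.\<close>

lemma jac_eq_downwards:
  assumes "jac q (Suc n) = jac r (Suc n)" "jac q n = jac r n" "j \<le> n"
  shows "jac q j = jac r j"
  using assms
proof (induction n)
  case (Suc n)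
  have *: "smult (of_real (q (Suc n)) - of_real (r (Suc n))) (jac q (Suc n)) = jac q n - jac r n"
    using Suc.prems(1,2) by (simp add: algebra_simps smult_diff_left)
  have "of_real (q (Suc n)) - of_real (r (Suc n)) = coeff (jac q n - jac r n) (Suc n)"
    unfolding *[symmetric] by simp
  also have "\<dots> = 0" by (simp add: coeff_eq_0)
  finally have "jac q n = jac r n" using * by simp
  then show ?case using Suc le_Suc_eq by metis
qed auto

section \<open>Spectral form of the evolution\<close>

text \<open>Squared length of the eigenvector when \<open>x\<close> is real, written without
  conjugates to match Christoffel-Darboux. At the roots its reciprocals are the spectral weights of
  vertex 0.\<close>

definition jac_norm :: "(nat \<Rightarrow> real) \<Rightarrow> nat \<Rightarrow> complex \<Rightarrow> complex" where
  "jac_norm q m x = (\<Sum>j<m. (poly (jac q j) x)\<^sup>2)"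

lemma jac_orthogonal_roots:
  assumes "x \<in> jac_roots q m" "y \<in> jac_roots q m"
  shows "(\<Sum>j<m. poly (jac q j) x * poly (jac q j) y) = (if x = y then jac_norm q m x else 0)"
proof (cases "x = y")
  case True
  then show ?thesis by (simp add: jac_norm_def power2_eq_square)
next
  case False
  show ?thesis
  proof (cases m)
    case (Suc k)
    have "(x - y) * (\<Sum>j<m. poly (jac q j) x * poly (jac q j) y) = 0"
      using assms christoffel_darboux[of x y q k] unfolding Suc lessThan_Suc_atMost by simp
    then show ?thesis using False by simp
  qed (use assms in auto)
qed

lemma jac_norm_nonzero:
  assumes "x \<in> jac_roots q m"
  shows "jac_norm q m x \<noteq> 0"
proof (cases m)
  case (Suc k)
  have c: "cnj x = x" using assms jac_root_real by blast
  have "jac_norm q m x = of_real (\<Sum>j\<le>k. (cmod (poly (jac q j) x))\<^sup>2)"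
    unfolding jac_norm_def Suc lessThan_Suc_atMost
    by (simp add: complex_norm_square jac_at_real[OF c] power2_eq_square[of "poly _ _"] del: of_real_power)
  then show ?thesis
    using sum_norm_jac_pos[of q x k] by (simp del: of_real_sum)
qed (use assms in auto)

lemma cnj_jac_norm:
  assumes "x \<in> jac_roots q m"
  shows "cnj (jac_norm q m x) = jac_norm q m x"
  using assms by (auto simp: jac_norm_def jac_at_real jac_root_real)

text \<open>Completeness of the eigenvectors. Orthogonality gives
  \<open>A * B = 1\<^sub>m m\<close>; there are exactly \<open>m\<close> roots, so the matrices are
  square and \<open>B * A = 1\<^sub>m m\<close> follows.\<close>

lemma jac_orthonormal:
  assumes "i < m" "j < m"
  shows "(\<Sum>x\<in>jac_roots q m. poly (jac q i) x * poly (jac q j) x / jac_norm q m x) = of_bool (i = j)"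
proof -
  obtain h where h: "bij_betw h {0..<m} (jac_roots q m)"
    using ex_bij_betw_nat_finite[of "jac_roots q m"] by auto
  then have hZ: "h l \<in> jac_roots q m" if "l < m" for l
    using that bij_betwE by fastforce
  define A where "A = mat m m (\<lambda>(l, j). poly (jac q j) (h l))"
  define B where "B = mat m m (\<lambda>(j, l). poly (jac q j) (h l) / jac_norm q m (h l))"
  have "A * B = 1\<^sub>m m"
  proof (rule eq_matI)
    fix k l assume "k < dim_row (1\<^sub>m m :: complex mat)" "l < dim_col (1\<^sub>m m :: complex mat)"
    then have kl: "k < m" "l < m" by auto
    have "(A * B) $$ (k, l) = (\<Sum>j<m. poly (jac q j) (h k) * poly (jac q j) (h l)) / jac_norm q m (h l)"
      using kl by (simp add: A_def B_def scalar_prod_def sum_divide_distrib atLeast0LessThan)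
    also have "\<dots> = 1\<^sub>m m $$ (k, l)"
      unfolding jac_orthogonal_roots[OF hZ[OF kl(1)] hZ[OF kl(2)]]
      using kl jac_norm_nonzero[OF hZ[OF kl(2)]] bij_betw_imp_inj_on[OF h]
      by (auto simp: inj_on_def)
    finally show "(A * B) $$ (k, l) = 1\<^sub>m m $$ (k, l)" .
  qed (auto simp: A_def B_def)
  then have "B * A = 1\<^sub>m m"
    by (rule mat_mult_left_right_inverse[rotated 2]) (auto simp: A_def B_def)
  then have "(B * A) $$ (i, j) = of_bool (i = j)" using assms by simp
  moreover have "(B * A) $$ (i, j) = (\<Sum>l\<in>{0..<m}. poly (jac q i) (h l) * poly (jac q j) (h l) / jac_norm q m (h l))"
    using assms by (simp add: A_def B_def scalar_prod_def)
  also have "\<dots> = (\<Sum>x\<in>jac_roots q m. poly (jac q i) x * poly (jac q j) x / jac_norm q m x)"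
    by (rule sum.reindex_bij_betw[OF h])
  finally show ?thesis by simp
qed

section \<open>Row 0 of the powers and of the evolution\<close>

lemma hamiltonian_carrier [simp]: "hamiltonian m q \<in> carrier_mat m m"
  by (auto simp: hamiltonian_def path_adj_def potential_mat_def)

lemma hamiltonian_dim [simp]: "dim_row (hamiltonian m q) = m" "dim_col (hamiltonian m q) = m"
  using hamiltonian_carrier carrier_matD by blast+

lemma hamiltonian_row:
  assumes "i < m"
  shows "(\<Sum>j<m. hamiltonian m q $$ (i, j) * f j) =
    (if Suc i < m then f (Suc i) else 0) + (if i > 0 then f (i - 1) else 0) - of_real (q i) * f i"
proof -
  have "(\<Sum>j<m. hamiltonian m q $$ (i, j) * f j) =
     (\<Sum>j<m. (if j = Suc i then f j else 0) + (if Suc j = i then f j else 0)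
        - (if j = i then of_real (q i) * f j else 0))"
    using assms by (intro sum.cong) (auto simp: hamiltonian_def path_adj_def potential_mat_def)
  also have "\<dots> = (\<Sum>j<m. if j = Suc i then f j else 0) + (\<Sum>j<m. if Suc j = i then f j else 0)
        - (\<Sum>j<m. if j = i then of_real (q i) * f j else 0)"
    by (simp add: sum.distrib sum_subtractf)
  also have "(\<Sum>j<m. if Suc j = i then f j else 0) = (\<Sum>j<m. if i > 0 \<and> j = i - 1 then f j else 0)"
    by (intro sum.cong) auto
  also have "\<dots> = (if i > 0 then f (i - 1) else 0)"
    using assms by auto
  finally show ?thesis using assms by simp
qed

lemma hamiltonian_eigenvector:
  assumes "x \<in> jac_roots q m" "i < m"
  shows "(\<Sum>j<m. hamiltonian m q $$ (i, j) * poly (jac q j) x) = x * poly (jac q i) x"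
proof -
  \<comment> \<open>In the last row the missing neighbour can be added, as its value is
    \<open>poly (jac q m) x = 0\<close>; every row is then the three-term recurrence.\<close>
  have *: "(if Suc i < m then poly (jac q (Suc i)) x else 0) = poly (jac q (Suc i)) x"
    using assms by (cases "Suc i = m") auto
  show ?thesis
    unfolding hamiltonian_row[OF assms(2)] * by (cases i) (auto simp: algebra_simps)
qed

lemma hamiltonian_power_eigenvector:
  assumes "x \<in> jac_roots q m" "0 < m"
  shows "(\<Sum>j<m. (hamiltonian m q ^\<^sub>m k) $$ (0, j) * poly (jac q j) x) = x ^ k"
proof (induction k)
  case 0
  have "(\<Sum>j<m. (hamiltonian m q ^\<^sub>m 0) $$ (0, j) * poly (jac q j) x)
     = (\<Sum>j<m. if j = 0 then poly (jac q j) x else 0)"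
    using assms by (intro sum.cong) auto
  then show ?case using assms by simp
next
  case (Suc k)
  let ?H = "hamiltonian m q"
  have d: "dim_col (?H ^\<^sub>m k) = m" "dim_row (?H ^\<^sub>m k) = m"
    using pow_carrier_mat[OF hamiltonian_carrier, of m q k] carrier_matD by blast+
  have "(\<Sum>j<m. (?H ^\<^sub>m Suc k) $$ (0, j) * poly (jac q j) x)
     = (\<Sum>j<m. \<Sum>l<m. (?H ^\<^sub>m k) $$ (0, l) * ?H $$ (l, j) * poly (jac q j) x)"
    using assms d by (intro sum.cong) (auto simp: scalar_prod_def sum_distrib_right atLeast0LessThan)
  also have "\<dots> = (\<Sum>l<m. (?H ^\<^sub>m k) $$ (0, l) * (\<Sum>j<m. ?H $$ (l, j) * poly (jac q j) x))"
    by (subst sum.swap) (simp add: sum_distrib_left mult.assoc)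
  also have "\<dots> = (\<Sum>l<m. (?H ^\<^sub>m k) $$ (0, l) * (x * poly (jac q l) x))"
    using assms(1) by (intro sum.cong refl) (simp add: hamiltonian_eigenvector)
  also have "\<dots> = x * x ^ k"
    unfolding Suc[symmetric] by (simp add: sum_distrib_left mult_ac)
  finally show ?case by simp
qed

lemma hamiltonian_power_row0:
  assumes "j < m"
  shows "(hamiltonian m q ^\<^sub>m k) $$ (0, j) =
    (\<Sum>x\<in>jac_roots q m. x ^ k * poly (jac q j) x / jac_norm q m x)"
proof -
  let ?f = "\<lambda>i. (hamiltonian m q ^\<^sub>m k) $$ (0, i)"
  have "(\<Sum>x\<in>jac_roots q m. x ^ k * poly (jac q j) x / jac_norm q m x)
     = (\<Sum>x\<in>jac_roots q m. (\<Sum>i<m. ?f i * poly (jac q i) x) * poly (jac q j) x / jac_norm q m x)"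
    using assms by (intro sum.cong refl) (simp add: hamiltonian_power_eigenvector)
  also have "\<dots> = (\<Sum>i<m. ?f i * (\<Sum>x\<in>jac_roots q m. poly (jac q i) x * poly (jac q j) x / jac_norm q m x))"
    by (simp add: sum_distrib_left sum_distrib_right sum_divide_distrib mult_ac, subst sum.swap) simp
  also have "\<dots> = (\<Sum>i<m. if i = j then ?f i else 0)"
    using assms by (intro sum.cong refl) (simp add: jac_orthonormal)
  finally show ?thesis using assms by simp
qed

lemma evolution_row0:
  assumes "j < m"
  shows "evolution (hamiltonian m q) T $$ (0, j) =
    (\<Sum>x\<in>jac_roots q m. exp (\<i> * of_real T * x) * (poly (jac q j) x / jac_norm q m x))"
proof -
  let ?c = "\<lambda>k. (\<i> * complex_of_real T) ^ k / of_nat (fact k)"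
  have "(\<lambda>k. ?c k * x ^ k * a) sums (exp (\<i> * of_real T * x) * a)" for x a
    using sums_mult2[OF exp_converges[of "\<i> * of_real T * x"], of a]
    by (simp add: scaleR_conv_of_real field_simps)
  then have "(\<lambda>k. \<Sum>x\<in>jac_roots q m. ?c k * x ^ k * (poly (jac q j) x / jac_norm q m x)) sums
     (\<Sum>x\<in>jac_roots q m. exp (\<i> * of_real T * x) * (poly (jac q j) x / jac_norm q m x))"
    by (intro sums_sum)
  moreover have "(\<Sum>x\<in>jac_roots q m. ?c k * x ^ k * (poly (jac q j) x / jac_norm q m x))
     = ?c k * (hamiltonian m q ^\<^sub>m k) $$ (0, j)" for k
    unfolding hamiltonian_power_row0[OF assms] by (simp add: sum_distrib_left mult.assoc)
  ultimately show ?thesis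
    using assms by (simp add: evolution_def sums_iff)
qed

lemma jac_root_Im:
  assumes "poly (jac q n) x = 0"
  shows "Im x = 0"
  using arg_cong[OF jac_root_real[OF assms], of Im] by simp

lemma evolution_row0_eigenvector:
  assumes "y \<in> jac_roots q m"
  shows "(\<Sum>j<m. evolution (hamiltonian m q) T $$ (0, j) * poly (jac q j) y) = exp (\<i> * of_real T * y)"
proof -
  let ?e = "\<lambda>x. exp (\<i> * of_real T * x)"
  have "(\<Sum>j<m. evolution (hamiltonian m q) T $$ (0, j) * poly (jac q j) y)
     = (\<Sum>j<m. \<Sum>x\<in>jac_roots q m. ?e x / jac_norm q m x * (poly (jac q j) x * poly (jac q j) y))"
    by (intro sum.cong refl) (simp add: evolution_row0 sum_distrib_left mult_ac)
  also have "\<dots> = (\<Sum>x\<in>jac_roots q m. ?e x / jac_norm q m x * (\<Sum>j<m. poly (jac q j) x * poly (jac q j) y))"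
    by (subst sum.swap) (simp add: sum_distrib_left)
  also have "\<dots> = (\<Sum>x\<in>jac_roots q m. if x = y then ?e x else 0)"
    using assms by (intro sum.cong refl) (simp add: jac_orthogonal_roots jac_norm_nonzero)
  finally show ?thesis using assms by simp
qed

text \<open>Parseval for row 0. Roots and \<open>T\<close> are real, so the phases have modulus 1
  and cancel; what remains is completeness at \<open>i = j = 0\<close>.\<close>

lemma evolution_row0_norm:
  assumes "0 < m"
  shows "(\<Sum>j<m. (cmod (evolution (hamiltonian m q) T $$ (0, j)))\<^sup>2) = 1"
proof -
  let ?e = "\<lambda>x. exp (\<i> * of_real T * x)"
  let ?u = "\<lambda>j. evolution (hamiltonian m q) T $$ (0, j)"
  have cu: "cnj (?u j) = (\<Sum>x\<in>jac_roots q m. cnj (?e x) * (poly (jac q j) x / jac_norm q m x))"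
    if "j < m" for j
    unfolding evolution_row0[OF that] cnj_sum
    by (intro sum.cong refl) (auto simp: cnj_jac_norm jac_at_real jac_root_real)
  have "complex_of_real (\<Sum>j<m. (cmod (?u j))\<^sup>2) = (\<Sum>j<m. ?u j * cnj (?u j))"
    by (simp add: complex_norm_square del: of_real_power)
  also have "\<dots> = (\<Sum>j<m. \<Sum>x\<in>jac_roots q m. cnj (?e x) / jac_norm q m x * (?u j * poly (jac q j) x))"
    by (intro sum.cong refl) (simp add: cu sum_distrib_left mult_ac)
  also have "\<dots> = (\<Sum>x\<in>jac_roots q m. cnj (?e x) / jac_norm q m x * (\<Sum>j<m. ?u j * poly (jac q j) x))"
    by (subst sum.swap) (simp add: sum_distrib_left)
  also have "\<dots> = (\<Sum>x\<in>jac_roots q m. cnj (?e x) / jac_norm q m x * ?e x)"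
    by (intro sum.cong refl) (simp add: evolution_row0_eigenvector)
  also have "\<dots> = (\<Sum>x\<in>jac_roots q m. (?e x * cnj (?e x)) / jac_norm q m x)"
    by (intro sum.cong refl) (simp add: mult_ac)
  also have "\<dots> = (\<Sum>x\<in>jac_roots q m. poly (jac q 0) x * poly (jac q 0) x / jac_norm q m x)"
    by (intro sum.cong refl) (simp add: complex_norm_square[symmetric] jac_root_Im del: of_real_power)
  also have "\<dots> = 1" using jac_orthonormal[of 0 m 0 q] assms by simp
  finally show ?thesis using of_real_eq_1_iff by blast
qed

text \<open>In a unit row an entry of modulus 1 forces all others to vanish, so pairing with an
  eigenvector keeps only the last term. The constant \<open>\<gamma>\<close> is that entry.\<close>

lemma pst_phases:
  assumes "0 < m" "pst (hamiltonian m q) 0 (m - 1) T"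
  obtains \<gamma> where "cmod \<gamma> = 1"
    "\<And>x. x \<in> jac_roots q m \<Longrightarrow> exp (\<i> * of_real T * x) = \<gamma> * poly (jac q (m - 1)) x"
proof
  let ?u = "\<lambda>j. evolution (hamiltonian m q) T $$ (0, j)"
  obtain n where m: "m = Suc n" using assms(1) gr0_conv_Suc by blast
  show u: "cmod (?u (m - 1)) = 1" using assms(2) by (simp add: pst_def)
  have "(\<Sum>j<n. (cmod (?u j))\<^sup>2) = 0"
    using evolution_row0_norm[OF assms(1), of q T] u by (simp add: m)
  then have 0: "?u j = 0" if "j < n" for j
    using that by (simp add: sum_nonneg_eq_0_iff)
  show "exp (\<i> * of_real T * x) = ?u (m - 1) * poly (jac q (m - 1)) x" if "x \<in> jac_roots q m" for x
    using evolution_row0_eigenvector[OF that, of T] 0 by (simp add: m)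
qed

section \<open>Mirror symmetry\<close>

text \<open>Run from the last vertex with \<open>poly (jac q m) x = 0\<close>, the recurrence
  becomes that of the reversed potential, scaled by the last component.\<close>

lemma jac_backward:
  assumes x: "x \<in> jac_roots q m" and "j < m"
  shows "poly (jac q (m - 1 - j)) x = poly (jac q (m - 1)) x * poly (jac (\<lambda>i. q (m - 1 - i)) j) x"
  using assms(2)
proof (induction j rule: induct_nat_012)
  case 1
  then obtain n where m: "m = Suc (Suc n)"
    using less_imp_Suc_add[of 1 m] by auto
  have "poly (jac q (Suc (Suc n))) x = 0" using x m by auto
  then have "poly (jac q n) x = (x + of_real (q (Suc n))) * poly (jac q (Suc n)) x"
    by (simp add: algebra_simps)
  then show ?case by (simp add: m algebra_simps)
next
  case (ge2 j)
  then obtain n where m: "m = Suc (Suc (Suc (j + n)))"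
    using less_imp_Suc_add[of "Suc (Suc j)" m] by auto
  have i: "m - 1 - j = Suc (Suc n)" "m - 1 - Suc j = Suc n" "m - 1 - Suc (Suc j) = n"
    "m - Suc (Suc j) = Suc n"
    using m by auto
  have "poly (jac q n) x = (x + of_real (q (Suc n))) * poly (jac q (Suc n)) x - poly (jac q (Suc (Suc n))) x"
    by (simp add: algebra_simps)
  moreover have "j < m" "Suc j < m" using m by auto
  ultimately show ?case
    using ge2(1,2) unfolding i by (simp add: i algebra_simps)
qed auto

lemma jac_reverse_root:
  assumes x: "x \<in> jac_roots q m"
  shows "poly (jac (\<lambda>i. q (m - 1 - i)) m) x = 0"
proof (cases m)
  case (Suc n)
  show ?thesis
  proof (cases n)
    case 0
    then show ?thesis using x Suc by auto
  next
    case (Suc k)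
    have m: "m = Suc (Suc k)" using \<open>m = Suc n\<close> Suc by simp
    let ?s = "poly (jac q (m - 1)) x"
    let ?r = "\<lambda>i. q (m - 1 - i)"
    \<comment> \<open>The first equation also shows \<open>?s\<close> to be nonzero, so that it can
      be cancelled at the end.\<close>
    have 1: "?s * poly (jac ?r (Suc k)) x = 1" "?s * poly (jac ?r k) x = x + of_real (q 0)"
      using jac_backward[OF x, of "Suc k"] jac_backward[OF x, of k] by (auto simp: m add.commute)
    have "?s * poly (jac ?r m) x =
        (x + of_real (q 0)) * (?s * poly (jac ?r (Suc k)) x) - ?s * poly (jac ?r k) x"
      by (simp add: m algebra_simps)
    also have "\<dots> = 0" unfolding 1 by simp
    finally show ?thesis using 1(1) by auto
  qed
qed (use x in auto)

text \<open>Reversal preserves the roots at level \<open>m\<close>. At level \<open>m - 1\<close>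
  the two polynomials take reciprocal values there, which are equal because they are signs;
  agreement at \<open>m\<close> points settles degree \<open>m - 1\<close>. These two levels
  determine all lower ones.\<close>

lemma jac_mirror:
  assumes s: "\<And>x. x \<in> jac_roots q m \<Longrightarrow> (poly (jac q (m - 1)) x)\<^sup>2 = 1"
    and x: "x \<in> jac_roots q m" and j: "j < m"
  shows "poly (jac q (m - 1 - j)) x = poly (jac q (m - 1)) x * poly (jac q j) x"
proof -
  obtain n where m: "m = Suc n" using j gr0_conv_Suc by (metis less_zeroE not_gr_zero)
  let ?r = "\<lambda>i. q (m - 1 - i)"
  have "jac q m = jac ?r m"
    by (rule poly_eqI_degree_lead_coeff[of _ m _ "jac_roots q m"])
      (use jac_reverse_root[of _ q m] in auto)
  moreover have "jac q n = jac ?r n"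
  proof (rule poly_eqI_degree)
    fix y assume y: "y \<in> jac_roots q m"
    have 1: "poly (jac q n) y * poly (jac ?r n) y = 1"
      using jac_backward[OF y, of n] by (simp add: m)
    have "poly (jac q n) y = poly (jac q n) y * (poly (jac q n) y * poly (jac ?r n) y)"
      unfolding 1 by simp
    also have "\<dots> = poly (jac ?r n) y"
      using s[OF y] by (simp add: m power2_eq_square mult.assoc[symmetric])
    finally show "poly (jac q n) y = poly (jac ?r n) y" .
  qed (auto simp: m)
  ultimately have "jac q j = jac ?r j"
    using jac_eq_downwards[of q n ?r j] j m by auto
  then show ?thesis using jac_backward[OF x j] by simp
qed

section \<open>Arithmetic of the eigenvalues\<close>

text \<open>Dividing by the phase at \<open>b\<close> removes \<open>\<gamma>\<close> and leaves
  \<open>- \<sigma> x\<close>, so \<open>T * (x - b)\<close> is a multiple of pi whose parity is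
  read off the sign. The spacing \<open>g\<close> is \<open>pi / T\<close>.\<close>

lemma phase_lattice:
  fixes Z :: "complex set"
  assumes ph: "\<And>x. x \<in> Z \<Longrightarrow> exp (\<i> * of_real T * x) = \<gamma> * \<sigma> x" and "\<gamma> \<noteq> 0"
    and real: "\<And>x. x \<in> Z \<Longrightarrow> Im x = 0"
    and \<sigma>: "\<And>x. x \<in> Z \<Longrightarrow> \<sigma> x = 1 \<or> \<sigma> x = -1"
    and a: "a \<in> Z" "\<sigma> a = 1" and b: "b \<in> Z" "\<sigma> b = -1"
  obtains g :: real and X :: "complex \<Rightarrow> int"
  where "\<And>x. x \<in> Z \<Longrightarrow> x = b + of_real g * of_int (X x)"
    and "\<And>x. x \<in> Z \<Longrightarrow> odd (X x) \<longleftrightarrow> \<sigma> x = 1"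
proof -
  let ?y = "\<lambda>x. T * Re x - T * Re b"
  have e: "exp (\<i> * of_real (?y x)) = - \<sigma> x" if x: "x \<in> Z" for x
  proof -
    have "x = of_real (Re x)" "b = of_real (Re b)"
      using real[OF x] real[OF b(1)] by (auto simp: complex_eq_iff)
    then have "\<i> * of_real (?y x) = \<i> * of_real T * x - \<i> * of_real T * b"
      by (metis (no_types, lifting) mult.assoc of_real_diff of_real_mult right_diff_distrib)
    then show ?thesis
      using ph[OF x] ph[OF b(1)] b(2) \<open>\<gamma> \<noteq> 0\<close> by (simp add: exp_diff)
  qed
  have "\<exists>n::int. ?y x = of_int n * pi \<and> (odd n \<longleftrightarrow> \<sigma> x = 1)" if x: "x \<in> Z" for x
  proof -
    have c: "cos (?y x) = Re (- \<sigma> x)"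
      unfolding e[OF x, symmetric] by (simp add: Re_exp)
    from \<sigma>[OF x] show ?thesis
    proof
      assume s: "\<sigma> x = 1"
      then have "cos (?y x + pi) = 1" using c by simp
      then obtain k :: int where "?y x + pi = of_int k * 2 * pi"
        using cos_one_2pi_int by blast
      then have "?y x = of_int (2 * k - 1) * pi" by (simp add: algebra_simps)
      then show ?thesis using s by (intro exI[of _ "2 * k - 1"]) auto
    next
      assume s: "\<sigma> x = -1"
      then have "cos (?y x) = 1" using c by simp
      then obtain k :: int where "?y x = of_int k * 2 * pi"
        using cos_one_2pi_int by blast
      then show ?thesis using s by (intro exI[of _ "2 * k"]) auto
    qed
  qed
  then obtain X :: "complex \<Rightarrow> int" where X: "\<And>x. x \<in> Z \<Longrightarrow> ?y x = of_int (X x) * pi"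
    "\<And>x. x \<in> Z \<Longrightarrow> odd (X x) \<longleftrightarrow> \<sigma> x = 1" by metis
  \<comment> \<open>For \<open>T = 0\<close> the integer \<open>X a\<close> would be 0, but it is
    odd.\<close>
  have "T \<noteq> 0"
    using X(1)[OF a(1)] X(2)[OF a(1)] a(2) by auto
  have "x = b + of_real (pi / T) * of_int (X x)" if x: "x \<in> Z" for x
    using X(1)[OF x] \<open>T \<noteq> 0\<close> real[OF x] real[OF b(1)]
    by (auto simp: complex_eq_iff field_simps)
  then show ?thesis using that X(2) by blast
qed

text \<open>Compare the exponents of 2 on both sides; \<open>v\<close> is the exponent in
  \<open>N\<close>.\<close>

lemma two_adic_exponent:
  fixes D N :: int
  assumes "odd D" "2 ^ a * D = 2 ^ b * N ^ p"
  shows "\<exists>v. a = b + p * v"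
proof -
  have "D \<noteq> 0" using assms(1) by auto
  then have "N ^ p \<noteq> 0" using assms(2) by (metis mult_eq_0_iff power_not_zero zero_neq_numeral)
  have "multiplicity 2 D = 0" using assms(1) by (simp add: not_dvd_imp_multiplicity_0)
  then have "a = multiplicity 2 (2 ^ a * D)"
    using \<open>D \<noteq> 0\<close> by (simp add: prime_elem_multiplicity_mult_distrib)
  also have "\<dots> = b + multiplicity 2 (N ^ p)"
    unfolding assms(2) using \<open>N ^ p \<noteq> 0\<close> by (simp add: prime_elem_multiplicity_mult_distrib)
  also have "multiplicity 2 (N ^ p) = p * multiplicity 2 N"
    using \<open>N ^ p \<noteq> 0\<close> by (cases "p = 0") (auto simp: prime_elem_multiplicity_power_distrib)
  finally show ?thesis by blast
qed

text \<open>Each of the \<open>card A * card B\<close> differences in the resultant is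
  \<open>g\<close> times an odd integer.\<close>

lemma odd_lattice_product:
  fixes A B :: "complex set" and X :: "complex \<Rightarrow> int"
  assumes "finite A" "finite B"
    and "\<And>x. x \<in> A \<union> B \<Longrightarrow> x = c + of_real g * of_int (X x)"
    and "\<And>x. x \<in> A \<Longrightarrow> odd (X x)" "\<And>x. x \<in> B \<Longrightarrow> even (X x)"
  obtains D :: int where "odd D"
    "cmod (\<Prod>a\<in>A. poly (\<Prod>z\<in>B. [:- z, 1:]) a) = \<bar>g\<bar> ^ (card A * card B) * of_int \<bar>D\<bar>"
proof
  define D where "D = (\<Prod>a\<in>A. \<Prod>b\<in>B. X a - X b)"
  show "odd D"
    using assms by (auto simp: D_def even_prod_iff)
  have "(\<Prod>a\<in>A. poly (\<Prod>z\<in>B. [:- z, 1:]) a) = (\<Prod>a\<in>A. \<Prod>b\<in>B. a - b)"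
    by (simp add: poly_prod)
  also have "\<dots> = (\<Prod>a\<in>A. \<Prod>b\<in>B. of_real g * of_int (X a - X b))"
  proof (intro prod.cong refl)
    fix a b assume "a \<in> A" "b \<in> B"
    then show "a - b = of_real g * of_int (X a - X b)"
      using assms(3)[of a] assms(3)[of b]
      by (metis UnI1 UnI2 add_diff_cancel_left of_int_diff right_diff_distrib)
  qed
  also have "\<dots> = of_real g ^ (card A * card B) * of_int D"
    by (simp add: D_def prod.distrib mult.commute[of "card A"] flip: power_mult)
  finally show "cmod (\<Prod>a\<in>A. poly (\<Prod>z\<in>B. [:- z, 1:]) a) = \<bar>g\<bar> ^ (card A * card B) * of_int \<bar>D\<bar>"
    by (simp add: norm_mult norm_power)
qed

lemma sum_lattice:
  fixes A :: "complex set" and X :: "complex \<Rightarrow> int"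
  assumes "\<And>x. x \<in> A \<Longrightarrow> x = c + of_real g * of_int (X x)"
  shows "\<Sum>A = of_nat (card A) * c + of_real g * of_int (\<Sum>x\<in>A. X x)"
proof -
  have "\<Sum>A = (\<Sum>x\<in>A. c + of_real g * of_int (X x))"
    by (rule sum.cong) (use assms in auto)
  then show ?thesis by (simp add: sum.distrib sum_distrib_left)
qed

text \<open>The left side is the second moment of \<open>A\<close> about \<open>e\<close>, expanded
  into power sums so that coefficients can be compared.\<close>

lemma sum_square_lattice:
  fixes A :: "complex set" and X :: "complex \<Rightarrow> int"
  assumes "\<And>x. x \<in> A \<Longrightarrow> x = e + of_real g * of_int (d + X x)"
  shows "(\<Sum>x\<in>A. x\<^sup>2) - 2 * e * \<Sum>A + of_nat (card A) * e\<^sup>2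
    = (of_real g)\<^sup>2 * of_int (\<Sum>x\<in>A. (d + X x)\<^sup>2)"
proof -
  have "(\<Sum>x\<in>A. x\<^sup>2) - 2 * e * \<Sum>A + of_nat (card A) * e\<^sup>2 = (\<Sum>x\<in>A. (x - e)\<^sup>2)"
    by (simp add: power2_diff sum.distrib sum_subtractf sum_distrib_left mult_ac)
  also have "\<dots> = (\<Sum>x\<in>A. (of_real g * of_int (d + X x))\<^sup>2)"
  proof (rule sum.cong[OF refl])
    fix x assume "x \<in> A"
    then have "x - e = of_real g * of_int (d + X x)"
      using assms by (metis add_diff_cancel_left')
    then show "(x - e)\<^sup>2 = (of_real g * of_int (d + X x))\<^sup>2" by simp
  qed
  also have "\<dots> = (of_real g)\<^sup>2 * of_int (\<Sum>x\<in>A. (d + X x)\<^sup>2)"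
    by (simp add: power_mult_distrib sum_distrib_left)
  finally show ?thesis .
qed

section \<open>Splitting the spectrum by sign\<close>

lemma pst_signs:
  assumes "cmod \<gamma> = 1"
    and "\<And>x. x \<in> jac_roots q m \<Longrightarrow> exp (\<i> * of_real T * x) = \<gamma> * poly (jac q (m - 1)) x"
    and x: "x \<in> jac_roots q m"
  shows "poly (jac q (m - 1)) x = 1 \<or> poly (jac q (m - 1)) x = -1"
proof -
  let ?s = "poly (jac q (m - 1)) x"
  have "cmod (exp (\<i> * of_real T * x)) = 1"
    using x jac_root_Im[of q m x] by simp
  then have "cmod ?s = 1"
    unfolding assms(2)[OF x] using assms(1) by (simp add: norm_mult)
  moreover have "cnj ?s = ?s"
    using x by (intro jac_at_real) (auto dest: jac_root_real)
  ultimately have "?s\<^sup>2 = 1"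
    by (metis complex_norm_square of_real_1 power2_eq_square power_one)
  then show ?thesis by (simp add: power2_eq_1_iff)
qed

lemma card_le_degree_of_roots:
  fixes f :: "complex poly"
  assumes "f \<noteq> 0" "\<And>x. x \<in> A \<Longrightarrow> poly f x = 0"
  shows "card A \<le> degree f"
proof -
  have "card A \<le> card {x. poly f x = 0}"
    using assms by (intro card_mono) (auto simp: poly_roots_finite)
  then show ?thesis using card_poly_roots_bound[OF assms(1)] by linarith
qed

text \<open>\<open>A\<close> and \<open>B\<close> collect the roots with last component 1 and -1.
  The lattice clause asks for both to be nonempty: its origin lies in \<open>B\<close>, and a point
  of \<open>A\<close> rules out \<open>T = 0\<close>.\<close>

lemma pst_root_classes:
  assumes "0 < m" and pst: "pst (hamiltonian m q) 0 (m - 1) T"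
  obtains A B :: "complex set" where "finite A" "finite B" "card A + card B = m"
    and "\<And>x j. x \<in> A \<Longrightarrow> j < m \<Longrightarrow> poly (jac q (m - 1 - j)) x = poly (jac q j) x"
    and "\<And>x j. x \<in> B \<Longrightarrow> j < m \<Longrightarrow> poly (jac q (m - 1 - j)) x = - poly (jac q j) x"
    and "A \<noteq> {} \<Longrightarrow> B \<noteq> {} \<Longrightarrow> \<exists>c (g::real) X :: complex \<Rightarrow> int.
      (\<forall>x\<in>A \<union> B. x = c + of_real g * of_int (X x)) \<and> (\<forall>x\<in>A. odd (X x)) \<and> (\<forall>x\<in>B. even (X x))"
proof -
  let ?Z = "jac_roots q m"
  define \<sigma> where "\<sigma> = (\<lambda>x. poly (jac q (m - 1)) x)"
  obtain \<gamma> where \<gamma>: "cmod \<gamma> = 1" "\<And>x. x \<in> ?Z \<Longrightarrow> exp (\<i> * of_real T * x) = \<gamma> * \<sigma> x"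
    using pst_phases[OF assms] unfolding \<sigma>_def by metis
  then have "\<gamma> \<noteq> 0" by auto
  have \<sigma>: "\<sigma> x = 1 \<or> \<sigma> x = -1" if "x \<in> ?Z" for x
    unfolding \<sigma>_def using pst_signs[OF \<gamma>(1) _ that] \<gamma>(2) unfolding \<sigma>_def by blast
  have mir: "poly (jac q (m - 1 - j)) x = \<sigma> x * poly (jac q j) x" if "x \<in> ?Z" "j < m" for x j
    unfolding \<sigma>_def
  proof (rule jac_mirror[OF _ that])
    show "(poly (jac q (m - 1)) y)\<^sup>2 = 1" if "y \<in> ?Z" for y
      using \<sigma>[OF that] by (simp add: \<sigma>_def power2_eq_1_iff)
  qed
  define A where "A = {x \<in> ?Z. \<sigma> x = 1}"
  define B where "B = {x \<in> ?Z. \<sigma> x = -1}"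
  show ?thesis
  proof (rule that[of A B])
    show "finite A" "finite B" by (auto simp: A_def B_def)
    have "?Z = A \<union> B" "A \<inter> B = {}" using \<sigma> by (auto simp: A_def B_def)
    then show "card A + card B = m"
      using card_Un_disjoint[of A B] \<open>finite A\<close> \<open>finite B\<close> card_jac_roots[of q m] by metis
    show "poly (jac q (m - 1 - j)) x = poly (jac q j) x" if "x \<in> A" "j < m" for x j
      using mir[of x j] that by (simp add: A_def)
    show "poly (jac q (m - 1 - j)) x = - poly (jac q j) x" if "x \<in> B" "j < m" for x j
      using mir[of x j] that by (simp add: B_def)
    assume "A \<noteq> {}" "B \<noteq> {}"
    then obtain a b where "a \<in> ?Z" "\<sigma> a = 1" "b \<in> ?Z" "\<sigma> b = -1" by (auto simp: A_def B_def)
    then obtain g X where gX: "\<And>x. x \<in> ?Z \<Longrightarrow> x = b + of_real g * of_int (X x)"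
        "\<And>x. x \<in> ?Z \<Longrightarrow> odd (X x) \<longleftrightarrow> \<sigma> x = 1"
      using phase_lattice[OF \<gamma>(2) \<open>\<gamma> \<noteq> 0\<close> _ \<sigma>, of ?Z a b] jac_root_Im by (metis (lifting) mem_Collect_eq)
    have "\<forall>x\<in>A. odd (X x)" "\<forall>x\<in>B. even (X x)"
      using gX(2) unfolding A_def B_def by force+
    then show "\<exists>c (g::real) X :: complex \<Rightarrow> int. (\<forall>x\<in>A \<union> B. x = c + of_real g * of_int (X x))
        \<and> (\<forall>x\<in>A. odd (X x)) \<and> (\<forall>x\<in>B. even (X x))"
      using gX(1) \<open>?Z = A \<union> B\<close> by blast
  qed
qed

section \<open>Paths with an even number of vertices\<close>

lemma no_pst_even_path:
  assumes k: "2 \<le> k" and m: "m = 2 * k"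
  shows "\<not> pst (hamiltonian m q) 0 (m - 1) T"
proof
  assume pst: "pst (hamiltonian m q) 0 (m - 1) T"
  obtain n where n: "k = Suc n" using k by (cases k) auto
  have "0 < m" using k m by simp
  show False
  proof (rule pst_root_classes[OF \<open>0 < m\<close> pst])
    fix A B :: "complex set"
    assume fin: "finite A" "finite B" and cardAB: "card A + card B = m"
      and sym: "\<And>x j. x \<in> A \<Longrightarrow> j < m \<Longrightarrow> poly (jac q (m - 1 - j)) x = poly (jac q j) x"
      and asym: "\<And>x j. x \<in> B \<Longrightarrow> j < m \<Longrightarrow> poly (jac q (m - 1 - j)) x = - poly (jac q j) x"
      and lattice: "A \<noteq> {} \<Longrightarrow> B \<noteq> {} \<Longrightarrow> \<exists>c (g::real) X :: complex \<Rightarrow> int.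
        (\<forall>x\<in>A \<union> B. x = c + of_real g * of_int (X x)) \<and> (\<forall>x\<in>A. odd (X x)) \<and> (\<forall>x\<in>B. even (X x))"
    \<comment> \<open>\<open>n\<close> and \<open>Suc n\<close> are the two middle vertices, which
      the reflection exchanges: \<open>R\<close> vanishes on symmetric eigenvectors and
      \<open>S\<close> on antisymmetric ones.\<close>
    define R where "R = jac q (Suc n) - jac q n"
    define S where "S = jac q (Suc n) + jac q n"
    have R: "degree R = Suc n" "lead_coeff R = 1"
      using degree_add_eq_left[of "- jac q n" "jac q (Suc n)"] by (auto simp: R_def coeff_eq_0)
    have S: "degree S = Suc n" "lead_coeff S = 1"
      using degree_add_eq_left[of "jac q n" "jac q (Suc n)"] by (auto simp: S_def coeff_eq_0)
    have i: "m - 1 - n = Suc n" "n < m" using n m by auto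
    have RA: "poly R x = 0" if "x \<in> A" for x using sym[OF that i(2)] unfolding i by (simp add: R_def)
    have SB: "poly S x = 0" if "x \<in> B" for x using asym[OF that i(2)] unfolding i by (simp add: S_def)
    have "R \<noteq> 0" "S \<noteq> 0" using R S by auto
    then have "card A \<le> k" "card B \<le> k"
      using card_le_degree_of_roots[of R A] card_le_degree_of_roots[of S B] R S RA SB n by auto
    then have card: "card A = k" "card B = k" using m cardAB by auto
    have RP: "R = (\<Prod>z\<in>A. [:- z, 1:])"
      by (rule monic_eq_prod) (use R RA card n in auto)
    have SP: "S = (\<Prod>z\<in>B. [:- z, 1:])"
      by (rule monic_eq_prod) (use S SB card n in auto)
    have ne: "A \<noteq> {}" "B \<noteq> {}" using card k by auto
    obtain b g X where X: "\<And>x. x \<in> A \<union> B \<Longrightarrow> x = b + of_real g * of_int (X x)"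
        "\<And>x. x \<in> A \<Longrightarrow> odd (X x)" "\<And>x. x \<in> B \<Longrightarrow> even (X x)"
      using lattice[OF ne] by blast
    obtain D where D: "odd D"
      "cmod (\<Prod>a\<in>A. poly S a) = \<bar>g\<bar> ^ (k * k) * of_int \<bar>D\<bar>"
      using odd_lattice_product[OF fin X] card by (auto simp: SP)
    \<comment> \<open>At a root of \<open>R\<close> the two middle components agree, so
      \<open>S\<close> is twice \<open>jac q n\<close> there.\<close>
    have "cmod (\<Prod>a\<in>A. poly S a) = cmod (\<Prod>a\<in>A. 2 * poly (jac q n) a)"
      using RA by (intro arg_cong[of _ _ cmod] prod.cong) (auto simp: R_def S_def)
    also have "\<dots> = 2 ^ k * cmod (\<Prod>a\<in>A. poly (jac q n) a)"
      by (simp add: prod.distrib norm_mult norm_power card)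
    also have "cmod (\<Prod>a\<in>A. poly (jac q n) a) = cmod (\<Prod>b\<in>jac_roots q n. poly R b)"
      unfolding RP using cmod_prod_poly_swap jac_eq_prod by metis
    also have "\<dots> = cmod (\<Prod>b\<in>jac_roots q n. poly (jac q (Suc n)) b)"
      by (simp add: R_def)
    also have "\<dots> = cmod (\<Prod>a\<in>jac_roots q (Suc n). poly (jac q n) a)"
      using cmod_prod_poly_swap jac_eq_prod by metis
    finally have res: "\<bar>g\<bar> ^ (k * k) * of_int \<bar>D\<bar> = 2 ^ k"
      using jac_resultant[of q n] D(2) by simp
    define N where "N = (\<Sum>x\<in>A. X x) - (\<Sum>x\<in>B. X x)"
    have "coeff R n = - \<Sum>A" "coeff S n = - \<Sum>B"
      unfolding RP SP using coeff_prod_linear_e1 fin card n by metis+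
    \<comment> \<open>\<open>S - R\<close> is twice the monic \<open>jac q n\<close>, whence the
      trace difference 2.\<close>
    then have "\<Sum>A - \<Sum>B = coeff S n - coeff R n" by simp
    then have "\<Sum>A - \<Sum>B = 2" by (simp add: R_def S_def)
    moreover have "\<Sum>A - \<Sum>B = of_real g * of_int N"
      using sum_lattice[of A b g X] sum_lattice[of B b g X] X(1) card
      by (simp add: N_def algebra_simps)
    ultimately have "cmod (of_real g * of_int N) = 2" by simp
    then have tr: "\<bar>g\<bar> * of_int \<bar>N\<bar> = 2" by (simp add: norm_mult)
    \<comment> \<open>The power \<open>k * k\<close> of the trace identity eliminates the real
      number \<open>g\<close> and leaves an equation between integers.\<close>
    have "of_int (2 ^ (k * k) * \<bar>D\<bar>) = (\<bar>g\<bar> * of_int \<bar>N\<bar>) ^ (k * k) * of_int \<bar>D\<bar>"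
      unfolding tr by simp
    also have "\<dots> = (\<bar>g\<bar> ^ (k * k) * of_int \<bar>D\<bar>) * of_int \<bar>N\<bar> ^ (k * k)"
      by (simp add: power_mult_distrib)
    also have "\<dots> = of_int (2 ^ k * \<bar>N\<bar> ^ (k * k))" unfolding res by simp
    finally have "2 ^ (k * k) * \<bar>D\<bar> = 2 ^ k * \<bar>N\<bar> ^ (k * k)"
      unfolding of_int_eq_iff .
    then obtain v where "k * k = k + k * k * v"
      using two_adic_exponent[of "\<bar>D\<bar>"] D(1) by (metis dvd_abs_iff)
    then have "k * k = k * (1 + k * v)" by (simp add: algebra_simps)
    \<comment> \<open>\<open>v = 0\<close> would give \<open>k = 1\<close>, and \<open>v > 0\<close>
      makes the right side exceed \<open>k\<close>.\<close>
    then have "k = 1 + k * v" using k by (metis mult_cancel1 not_numeral_le_zero)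
    then show False using k by (cases v) auto
  qed
qed

section \<open>Paths with an odd number of vertices\<close>

lemma no_pst_odd_path:
  assumes k: "2 \<le> k" and m: "m = 2 * k + 1"
  shows "\<not> pst (hamiltonian m q) 0 (m - 1) T"
proof
  assume pst: "pst (hamiltonian m q) 0 (m - 1) T"
  \<comment> \<open>\<open>l\<close> is the degree of the coefficient of \<open>S\<close> two below
    the top, needed for second moments.\<close>
  obtain l where l: "k = Suc (Suc l)" using k by (cases k; cases "k - 1") auto
  define n where "n = Suc l"
  have n: "k = Suc n" using l by (simp add: n_def)
  have "0 < m" using k m by simp
  show False
  proof (rule pst_root_classes[OF \<open>0 < m\<close> pst])
    fix A B :: "complex set"
    assume fin: "finite A" "finite B" and cardAB: "card A + card B = m"
      and sym: "\<And>x j. x \<in> A \<Longrightarrow> j < m \<Longrightarrow> poly (jac q (m - 1 - j)) x = poly (jac q j) x"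
      and asym: "\<And>x j. x \<in> B \<Longrightarrow> j < m \<Longrightarrow> poly (jac q (m - 1 - j)) x = - poly (jac q j) x"
      and lattice: "A \<noteq> {} \<Longrightarrow> B \<noteq> {} \<Longrightarrow> \<exists>c (g::real) X :: complex \<Rightarrow> int.
        (\<forall>x\<in>A \<union> B. x = c + of_real g * of_int (X x)) \<and> (\<forall>x\<in>A. odd (X x)) \<and> (\<forall>x\<in>B. even (X x))"
    \<comment> \<open>The reflection fixes the central vertex \<open>Suc n\<close> and exchanges its
      neighbours. Antisymmetric eigenvectors vanish at the centre, hence the choice of
      \<open>S\<close>.\<close>
    define R where "R = jac q (Suc (Suc n)) - jac q n"
    define S where "S = jac q (Suc n)"
    have R: "degree R = Suc (Suc n)" "lead_coeff R = 1"
      using degree_add_eq_left[of "- jac q n" "jac q (Suc (Suc n))"] lead_coeff_jac[of q "Suc (Suc n)"]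
      by (auto simp: R_def coeff_eq_0 simp del: jac.simps lead_coeff_jac)
    have S: "degree S = Suc n" "lead_coeff S = 1"
      by (auto simp: S_def)
    have i: "m - 1 - n = Suc (Suc n)" "m - 1 - Suc n = Suc n" "n < m" "Suc n < m" using n m by auto
    have RA: "poly R x = 0" if "x \<in> A" for x
      using sym[OF that i(3)] unfolding i by (simp add: R_def del: jac.simps)
    have SB: "poly S x = 0" if "x \<in> B" for x
      using asym[OF that i(4)] unfolding i by (simp add: S_def)
    have "R \<noteq> 0" "S \<noteq> 0" using R S by auto
    then have "card A \<le> Suc k" "card B \<le> k"
      using card_le_degree_of_roots[of R A] card_le_degree_of_roots[of S B] R S RA SB n by auto
    then have card: "card A = Suc k" "card B = k" using m cardAB by auto
    have RP: "R = (\<Prod>z\<in>A. [:- z, 1:])"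
      by (rule monic_eq_prod) (use R RA card n in auto)
    have SP: "S = (\<Prod>z\<in>B. [:- z, 1:])"
      by (rule monic_eq_prod) (use S SB card n in auto)
    have ne: "A \<noteq> {}" "B \<noteq> {}" using card k by auto
    obtain b g X where X: "\<And>x. x \<in> A \<union> B \<Longrightarrow> x = b + of_real g * of_int (X x)"
        "\<And>x. x \<in> A \<Longrightarrow> odd (X x)" "\<And>x. x \<in> B \<Longrightarrow> even (X x)"
      using lattice[OF ne] by blast
    define p where "p = Suc k * k"
    obtain D where D: "odd D"
      "cmod (\<Prod>a\<in>A. poly S a) = \<bar>g\<bar> ^ p * of_int \<bar>D\<bar>"
      using odd_lattice_product[OF fin X] card by (auto simp: SP p_def)
    \<comment> \<open>The diagonal entry of the Hamiltonian at the central vertex.\<close>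
    define e where "e = - complex_of_real (q (Suc n))"
    have Rrec: "R = [:- e, 1:] * S - smult 2 (jac q n)"
      by (simp add: R_def S_def e_def numeral_poly)
    have SR: "B = jac_roots q (Suc n)"
      by (rule card_seteq) (use SB card n in \<open>auto simp: S_def\<close>)
    have "cmod (\<Prod>a\<in>A. poly S a) = cmod (\<Prod>b\<in>B. poly R b)"
      unfolding RP SP by (rule cmod_prod_poly_swap)
    also have "\<dots> = cmod (\<Prod>b\<in>B. - 2 * poly (jac q n) b)"
      using SB by (intro arg_cong[of _ _ cmod] prod.cong) (auto simp: Rrec)
    also have "\<dots> = 2 ^ k * cmod (\<Prod>b\<in>B. poly (jac q n) b)"
      unfolding prod.distrib norm_mult prod_constant card by (simp add: norm_power)
    finally have res: "\<bar>g\<bar> ^ p * of_int \<bar>D\<bar> = 2 ^ k"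
      using jac_resultant[of q n] D(2) SR by simp
    \<comment> \<open>Chosen so that \<open>b = e + g * d\<close>: the trace comparison
      \<open>\<Sum>A = \<Sum>B + e\<close> puts \<open>e\<close> itself on the lattice.\<close>
    define d where "d = (\<Sum>x\<in>B. X x) - (\<Sum>x\<in>A. X x)"
    \<comment> \<open>Difference of the second moments about \<open>e\<close>, in units of the
      square of \<open>g\<close>. With this centre all terms in \<open>e\<close> cancel and the
      constant 4 remains.\<close>
    define N where "N = (\<Sum>x\<in>A. (d + X x)\<^sup>2) - (\<Sum>x\<in>B. (d + X x)\<^sup>2)"
    have e1: "coeff R (Suc n) = - \<Sum>A" "coeff S n = - \<Sum>B"
      unfolding RP SP using coeff_prod_linear_e1 fin card n by metis+
    have e2: "2 * coeff R n = (\<Sum>A)\<^sup>2 - (\<Sum>x\<in>A. x\<^sup>2)" "2 * coeff S l = (\<Sum>B)\<^sup>2 - (\<Sum>x\<in>B. x\<^sup>2)"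
      unfolding RP SP using coeff_prod_linear_e2 fin card n l by metis+
    have c: "coeff R (Suc n) = coeff S n - e" "coeff R n = coeff S l - e * coeff S n - 2"
      using S lead_coeff_jac[of q n] unfolding Rrec n_def by (auto simp: coeff_eq_0)
    have s1: "\<Sum>A = \<Sum>B + e"
      using c(1) unfolding e1 by (simp add: algebra_simps)
    have "2 * coeff R n = 2 * coeff S l - 2 * e * coeff S n - 4"
      unfolding c(2) by (simp add: algebra_simps)
    then have s2: "(\<Sum>A)\<^sup>2 - (\<Sum>x\<in>A. x\<^sup>2) = (\<Sum>B)\<^sup>2 - (\<Sum>x\<in>B. x\<^sup>2) + 2 * e * \<Sum>B - 4"
      unfolding e2 e1(2) by simp
    have "b = e + of_real g * of_int d"
      using s1 sum_lattice[of A b g X] sum_lattice[of B b g X] X(1) card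
      by (simp add: d_def algebra_simps)
    then have Xd: "x = e + of_real g * of_int (d + X x)" if "x \<in> A \<union> B" for x
      using X(1)[OF that] by (simp add: algebra_simps)
    have "(of_real g)\<^sup>2 * of_int N = ((\<Sum>x\<in>A. x\<^sup>2) - 2 * e * \<Sum>A + of_nat (card A) * e\<^sup>2) -
        ((\<Sum>x\<in>B. x\<^sup>2) - 2 * e * \<Sum>B + of_nat (card B) * e\<^sup>2)"
      using sum_square_lattice[of A e g d X] sum_square_lattice[of B e g d X] Xd
      by (simp add: N_def algebra_simps)
    also have "\<dots> = 4"
      using s2 unfolding s1 card by (simp add: algebra_simps power2_eq_square)
    finally have "complex_of_real (g\<^sup>2 * of_int N) = of_real 4" by simp
    then have tr: "g\<^sup>2 * of_int N = 4" by (simp only: of_real_eq_iff)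
    \<comment> \<open>Only the square of \<open>g\<close> is tied to \<open>N\<close>, so the
      resultant identity is squared before \<open>g\<close> is eliminated.\<close>
    have gp: "(g\<^sup>2) ^ p = (\<bar>g\<bar> ^ p)\<^sup>2"
      by (metis mult.commute power2_abs power_mult)
    have "of_int (2 ^ (2 * p) * D\<^sup>2) = (g\<^sup>2 * of_int N) ^ p * (of_int \<bar>D\<bar>)\<^sup>2"
      unfolding tr by (simp add: power_mult)
    also have "\<dots> = (\<bar>g\<bar> ^ p * of_int \<bar>D\<bar>)\<^sup>2 * of_int N ^ p"
      unfolding power_mult_distrib gp by (simp only: mult_ac)
    also have "\<dots> = of_int (2 ^ (2 * k) * N ^ p)"
      unfolding res by (simp add: mult.commute flip: power_mult)
    finally have "2 ^ (2 * p) * D\<^sup>2 = 2 ^ (2 * k) * N ^ p"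
      unfolding of_int_eq_iff .
    then obtain v where "2 * p = 2 * k + p * v"
      using two_adic_exponent[of "D\<^sup>2"] D(1) by (metis even_power)
    \<comment> \<open>Cancelling \<open>k\<close> makes \<open>Suc k\<close>, which is at least 3, a
      divisor of 2.\<close>
    then have "k * (2 * Suc k) = k * (2 + Suc k * v)" by (simp add: p_def algebra_simps)
    then have "2 * Suc k = 2 + Suc k * v" using k by (metis mult_cancel1 not_numeral_le_zero)
    then have "Suc k dvd 2" by (metis dvd_add_left_iff dvd_triv_left dvd_triv_right)
    then show False using k by (auto dest: dvd_imp_le)
  qed
qed

theorem theorem1:
  fixes m :: nat and q :: "nat \<Rightarrow> real"
  assumes "m \<ge> 4"
  shows "\<not> (\<exists>T::real. pst (hamiltonian m q) 0 (m - 1) T)"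
proof -
  consider k where "2 \<le> k" "m = 2 * k" | k where "2 \<le> k" "m = 2 * k + 1"
    using assms by (cases "even m") (auto elim!: evenE oddE)
  then show ?thesis
    using no_pst_even_path no_pst_odd_path by metis
qed

end
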